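(* Let $X$ and $Y$ be real Banach spaces, and let $\beta_X$ and $\beta_Y$ be vector bornologies on $X$ and $Y$ respectively such that $\beta_X$ satisfies property $(S)$. Let $T:Y\to X$ be a (not necessarily linear) map that is $\beta_Y$-p.h. differentiable at $0$ and such that $d_{\beta_Y}^{ph}T(0)$ is not a $\beta_Y$-$\beta_X$-operator. Let $\mathcal{F}$ be the set of functions $f\in\mathrm{Lip}_0(X)$ such that $f$ is $\beta_X$-differentiable at $0$ with $\beta_X$-differential equal to $0$, but $f\circ T$ is not $\beta_Y$-differentiable at $0$. Then $\mathcal{F}\cup\{0\}$ contains a linear subspace of $\mathrm{Lip}_0(X)$ that is isometric to $\ell^\infty(\mathbb{N})$.
   Context: $\mathrm{Lip}_0(X)$ denotes the space of Lipschitz functions $f:X\to\mathbb{R}$ with $f(0)=0$, normed by $\mathrm{Lip}(f)$, the smallest Lipschitz constant of $f$. A bornology on a real Banach space $X$ is a family $\beta$ of nonempty bounded subsets of $X$ such that $\bigcup_{A\in\beta}A=X$; $A\cup B\in\beta$ for all $A,B\in\beta$; and every nonempty $B\subset A$ with $A\in\beta$ belongs to $\beta$. It is a vector bornology if moreover, for every $A\in\beta$, $\lambda\in\mathbb{R}$ and $x\in X$, one has $\mathrm{bal}(A):=\{\mu a: a\in A,\ |\mu|\le 1\}\in\beta$ and $x+\lambda A\in\beta$. A vector bornology $\beta$ on $X$ satisfies property $(S)$ if for every nonempty bounded set $A\subset X$ with $A\notin\beta$ there are a sequence $(x_n)_n\subset A$ and $\delta>0$ such that for every increasing sequence $(n_k)_k\subset\mathbb{N}$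 and every sequence $(y_k)_k\subset X$ with $\|y_k-x_{n_k}\|\le\delta$ for all $k$, the set $\{y_k:k\in\mathbb{N}\}$ does not belong to $\beta$. A map $R:Y\to X$ (not necessarily linear) is a $\beta_Y$-$\beta_X$-operator if $R(A)\in\beta_X$ for all $A\in\beta_Y$. Let $\beta$ be a bornology on a Banach space $Y$ and $Z$ a Banach space. A map $T:Y\to Z$ is $\beta$-differentiable at $y$ if there is a bounded linear operator $d_\beta T(y):Y\to Z$ (the $\beta$-differential) with $\lim_{t\to0}\sup_{u\in A}\left\|\frac{T(y+tu)-T(y)}{t}-d_\beta T(y)(u)\right\|=0$ for all $A\in\beta$. It is $\beta$-p.h. differentiable (positively homogeneous differentiable) at $y$ if there is a continuous positively homogeneous map $R:Y\to Z$ with $\lim_{t\to0^+}\sup_{u\in A}\left\|\frac{T(y+tu)-T(y)}{t}-R(u)\right\|=0$ for all $A\in\beta$; this $R$ is unique and denoted $d_\beta^{ph}T(y)$. *)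

theory Defs
  imports "HOL-Analysis.Analysis"
begin

section \<open>The normed space of Lipschitz functions vanishing at the origin\<close>

definition is_lip0 :: "('a::real_normed_vector \<Rightarrow> real) \<Rightarrow> bool" where
  "is_lip0 f \<longleftrightarrow> f 0 = 0 \<and> (\<exists>C. C-lipschitz_on UNIV f)"

text \<open>The infimum is attained for Lipschitz functions (see \<open>lipschitz_on_Lip\<close> below), so it is
  the smallest Lipschitz constant. The constants in \<^const>\<open>lipschitz_on\<close> are nonnegative by
  definition.\<close>

definition Lip :: "('a::metric_space \<Rightarrow> real) \<Rightarrow> real" where
  "Lip f = Inf {C. C-lipschitz_on UNIV f}"

lemma Lip_le:
  assumes "C-lipschitz_on UNIV f"
  shows "Lip f \<le> C"
  unfolding Lip_def
  by (rule cInf_lower) (use assms in \<open>auto intro!: bdd_belowI[of _ 0] dest: lipschitz_on_nonneg\<close>)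

lemma Lip_nonneg:
  assumes "C-lipschitz_on UNIV f"
  shows "0 \<le> Lip f"
  unfolding Lip_def
  by (rule cInf_greatest) (use assms in \<open>auto dest: lipschitz_on_nonneg\<close>)

lemma lipschitz_on_Lip:
  assumes "C-lipschitz_on UNIV f"
  shows "(Lip f)-lipschitz_on UNIV f"
proof (rule lipschitz_onI)
  fix x y
  show "dist (f x) (f y) \<le> Lip f * dist x y"
  proof (cases "x = y")
    case False
    have "dist (f x) (f y) / dist x y \<le> Lip f"
      unfolding Lip_def
    proof (rule cInf_greatest)
      fix D assume "D \<in> {C. C-lipschitz_on UNIV f}"
      then have "dist (f x) (f y) \<le> D * dist x y" by (auto dest: lipschitz_onD)
      then show "dist (f x) (f y) / dist x y \<le> D" using False by (simp add: divide_le_eq)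
    qed (use assms in auto)
    then show ?thesis using False by (simp add: divide_le_eq)
  qed simp
qed (rule Lip_nonneg[OF assms])

typedef (overloaded) ('a::real_normed_vector) lip0 = "{f :: 'a \<Rightarrow> real. is_lip0 f}"
  morphisms lip0_apply Abs_lip0
  by (rule exI[of _ "\<lambda>_. 0"]) (auto simp: is_lip0_def intro: lipschitz_on_constant)

setup_lifting type_definition_lip0

lemma lip0_eqI: "(\<And>x. lip0_apply f x = lip0_apply g x) \<Longrightarrow> f = g"
  by (simp add: lip0_apply_inject[symmetric] fun_eq_iff)

lemma lip0_apply_0 [simp]: "lip0_apply f 0 = 0"
  using lip0_apply[of f] by (simp add: is_lip0_def)

lemma lip0_lipschitz: "(Lip (lip0_apply f))-lipschitz_on UNIV (lip0_apply f)"
  using lip0_apply[of f] by (auto simp: is_lip0_def intro: lipschitz_on_Lip)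

instantiation lip0 :: (real_normed_vector) real_normed_vector
begin

lift_definition zero_lip0 :: "'a lip0" is "\<lambda>_. 0"
  by (auto simp: is_lip0_def intro: lipschitz_on_constant)

lift_definition plus_lip0 :: "'a lip0 \<Rightarrow> 'a lip0 \<Rightarrow> 'a lip0" is "\<lambda>f g x. f x + g x"
  by (auto simp: is_lip0_def intro: lipschitz_on_add)

lift_definition minus_lip0 :: "'a lip0 \<Rightarrow> 'a lip0 \<Rightarrow> 'a lip0" is "\<lambda>f g x. f x - g x"
  by (auto simp: is_lip0_def intro: lipschitz_on_diff)

lift_definition uminus_lip0 :: "'a lip0 \<Rightarrow> 'a lip0" is "\<lambda>f x. - f x"
  by (auto simp: is_lip0_def)

lift_definition scaleR_lip0 :: "real \<Rightarrow> 'a lip0 \<Rightarrow> 'a lip0" is "\<lambda>r f x. r * f x"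
  by (auto simp: is_lip0_def intro: lipschitz_on_cmult_real)

lift_definition norm_lip0 :: "'a lip0 \<Rightarrow> real" is Lip .

definition dist_lip0 :: "'a lip0 \<Rightarrow> 'a lip0 \<Rightarrow> real" where
  "dist_lip0 f g = norm (f - g)"

definition sgn_lip0 :: "'a lip0 \<Rightarrow> 'a lip0" where
  "sgn_lip0 f = inverse (norm f) *\<^sub>R f"

definition uniformity_lip0 :: "('a lip0 \<times> 'a lip0) filter" where
  "uniformity_lip0 = (INF e\<in>{0 <..}. principal {(x, y). dist x y < e})"

definition open_lip0 :: "'a lip0 set \<Rightarrow> bool" where
  "open_lip0 U = (\<forall>x\<in>U. \<forall>\<^sub>F (x', y) in uniformity. x' = x \<longrightarrow> y \<in> U)"

instance
proof
  fix f g h :: "'a lip0" and r s :: real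
  show "f + g + h = f + (g + h)" "f + g = g + f" "0 + f = f" "- f + f = 0" "f - g = f + - g"
    by (transfer; simp add: fun_eq_iff)+
  show "r *\<^sub>R (f + g) = r *\<^sub>R f + r *\<^sub>R g" "(r + s) *\<^sub>R f = r *\<^sub>R f + s *\<^sub>R f"
    "r *\<^sub>R s *\<^sub>R f = (r * s) *\<^sub>R f" "1 *\<^sub>R f = f"
    by (transfer; simp add: fun_eq_iff algebra_simps)+
  show "dist f g = norm (f - g)" by (fact dist_lip0_def)
  show "sgn f = inverse (norm f) *\<^sub>R f" by (fact sgn_lip0_def)
  show "(uniformity :: ('a lip0 \<times> 'a lip0) filter) =
      (INF e\<in>{0 <..}. principal {(x, y). dist x y < e})"
    by (fact uniformity_lip0_def)
  show "open U = (\<forall>x\<in>U. \<forall>\<^sub>F (x', y) in uniformity. x' = x \<longrightarrow> y \<in> U)" for U :: "'a lip0 set"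
    by (fact open_lip0_def)
  show "norm f = 0 \<longleftrightarrow> f = 0"
  proof
    assume "norm f = 0"
    then have "lip0_apply f x = 0" for x
      using lipschitz_onD[OF lip0_lipschitz[of f], of x 0] by (simp add: norm_lip0.rep_eq)
    then show "f = 0" by (intro lip0_eqI) (simp add: zero_lip0.rep_eq)
  next
    have zero: "0-lipschitz_on UNIV (\<lambda>_::'a. 0::real)" by (rule lipschitz_on_constant)
    assume "f = 0"
    then show "norm f = 0"
      using Lip_le[OF zero] Lip_nonneg[OF zero] by (simp add: norm_lip0.rep_eq zero_lip0.rep_eq)
  qed
  show "norm (f + g) \<le> norm f + norm g"
    unfolding norm_lip0.rep_eq plus_lip0.rep_eq
    by (intro Lip_le lipschitz_on_add lip0_lipschitz)
  have scale: "norm (c *\<^sub>R k) \<le> \<bar>c\<bar> * norm k" for c and k :: "'a lip0"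
    unfolding norm_lip0.rep_eq scaleR_lip0.rep_eq
    by (intro Lip_le lipschitz_on_cmult_real lip0_lipschitz)
  show "norm (r *\<^sub>R f) = \<bar>r\<bar> * norm f"
  proof (rule antisym[OF scale])
    show "\<bar>r\<bar> * norm f \<le> norm (r *\<^sub>R f)"
    proof (cases "r = 0")
      case True
      then show ?thesis
        unfolding norm_lip0.rep_eq using Lip_nonneg[OF lip0_lipschitz[of "r *\<^sub>R f"]] by simp
    next
      case False
      have "inverse r *\<^sub>R r *\<^sub>R f = f"
        by (rule lip0_eqI) (use False in \<open>simp add: scaleR_lip0.rep_eq\<close>)
      then show ?thesis
        using scale[of "inverse r" "r *\<^sub>R f"] False by (simp add: field_simps)
    qed
  qed
qed

end

section \<open>Bornologies\<close>

definition bornology :: "'a::real_normed_vector set set \<Rightarrow> bool" where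
  "bornology \<beta> \<longleftrightarrow>
     (\<forall>A\<in>\<beta>. A \<noteq> {} \<and> bounded A) \<and>
     \<Union>\<beta> = UNIV \<and>
     (\<forall>A\<in>\<beta>. \<forall>B\<in>\<beta>. A \<union> B \<in> \<beta>) \<and>
     (\<forall>A\<in>\<beta>. \<forall>B. B \<noteq> {} \<and> B \<subseteq> A \<longrightarrow> B \<in> \<beta>)"

definition bal :: "'a::real_vector set \<Rightarrow> 'a set" where
  "bal A = {\<mu> *\<^sub>R a | \<mu> a. a \<in> A \<and> \<bar>\<mu>\<bar> \<le> 1}"

definition vector_bornology :: "'a::real_normed_vector set set \<Rightarrow> bool" where
  "vector_bornology \<beta> \<longleftrightarrow> bornology \<beta> \<and>
     (\<forall>A\<in>\<beta>. \<forall>l x. bal A \<in> \<beta> \<and> (\<lambda>a. x + l *\<^sub>R a) ` A \<in> \<beta>)"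

text \<open>``Increasing sequence of indices'' is read as strictly increasing. With constant index
  sequences allowed, taking \<open>y k = x (n 0)\<close> for all \<open>k\<close> gives a singleton, so the property could
  only hold vacuously.\<close>

definition property_S :: "'a::real_normed_vector set set \<Rightarrow> bool" where
  "property_S \<beta> \<longleftrightarrow>
     (\<forall>A. A \<noteq> {} \<and> bounded A \<and> A \<notin> \<beta> \<longrightarrow>
       (\<exists>x :: nat \<Rightarrow> 'a. \<exists>\<delta>>0. (\<forall>n. x n \<in> A) \<and>
         (\<forall>n :: nat \<Rightarrow> nat. \<forall>y :: nat \<Rightarrow> 'a.
            strict_mono n \<and> (\<forall>k. norm (y k - x (n k)) \<le> \<delta>) \<longrightarrow> range y \<notin> \<beta>)))"

definition bornology_operator :: "'b set set \<Rightarrow> 'a set set \<Rightarrow> ('b \<Rightarrow> 'a) \<Rightarrow> bool" where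
  "bornology_operator \<beta>Y \<beta>X R \<longleftrightarrow> (\<forall>A\<in>\<beta>Y. R ` A \<in> \<beta>X)"

section \<open>Differentiability with respect to a bornology\<close>

text \<open>The suprema are taken in \<^typ>\<open>ennreal\<close> because the difference quotients of an arbitrary map
  need not be bounded on \<open>A\<close>.\<close>

definition has_bornology_derivative ::
  "'b set set \<Rightarrow> ('b::real_normed_vector \<Rightarrow> 'c::real_normed_vector) \<Rightarrow> ('b \<Rightarrow> 'c) \<Rightarrow> 'b \<Rightarrow> bool" where
  "has_bornology_derivative \<beta> T D y \<longleftrightarrow> bounded_linear D \<and>
     (\<forall>A\<in>\<beta>. ((\<lambda>t::real. SUP u\<in>A. ennreal (norm ((T (y + t *\<^sub>R u) - T y) /\<^sub>R t - D u))) \<longlongrightarrow> 0) (at 0))"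

definition bornology_differentiable ::
  "'b set set \<Rightarrow> ('b::real_normed_vector \<Rightarrow> 'c::real_normed_vector) \<Rightarrow> 'b \<Rightarrow> bool" where
  "bornology_differentiable \<beta> T y \<longleftrightarrow> (\<exists>D. has_bornology_derivative \<beta> T D y)"

definition positively_homogeneous :: "('b::real_vector \<Rightarrow> 'c::real_vector) \<Rightarrow> bool" where
  "positively_homogeneous R \<longleftrightarrow> (\<forall>l\<ge>0. \<forall>u. R (l *\<^sub>R u) = l *\<^sub>R R u)"

definition has_bornology_ph_derivative ::
  "'b set set \<Rightarrow> ('b::real_normed_vector \<Rightarrow> 'c::real_normed_vector) \<Rightarrow> ('b \<Rightarrow> 'c) \<Rightarrow> 'b \<Rightarrow> bool" where
  "has_bornology_ph_derivative \<beta> T R y \<longleftrightarrow> continuous_on UNIV R \<and> positively_homogeneous R \<and>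
     (\<forall>A\<in>\<beta>. ((\<lambda>t::real. SUP u\<in>A. ennreal (norm ((T (y + t *\<^sub>R u) - T y) /\<^sub>R t - R u))) \<longlongrightarrow> 0)
       (at_right 0))"

definition bornology_ph_differentiable ::
  "'b set set \<Rightarrow> ('b::real_normed_vector \<Rightarrow> 'c::real_normed_vector) \<Rightarrow> 'b \<Rightarrow> bool" where
  "bornology_ph_differentiable \<beta> T y \<longleftrightarrow> (\<exists>R. has_bornology_ph_derivative \<beta> T R y)"

definition bornology_ph_derivative ::
  "'b set set \<Rightarrow> ('b::real_normed_vector \<Rightarrow> 'c::real_normed_vector) \<Rightarrow> 'b \<Rightarrow> ('b \<Rightarrow> 'c)" where
  "bornology_ph_derivative \<beta> T y = (THE R. has_bornology_ph_derivative \<beta> T R y)"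

lemma has_bornology_ph_derivative_unique:
  assumes "bornology \<beta>" "has_bornology_ph_derivative \<beta> T R y" "has_bornology_ph_derivative \<beta> T S y"
  shows "R = S"
proof
  fix u
  have "{u} \<in> \<beta>"
    using assms(1) unfolding bornology_def by (metis UNIV_I UnionE empty_not_insert empty_subsetI insert_subset)
  moreover have "((\<lambda>t. (T (y + t *\<^sub>R u) - T y) /\<^sub>R t) \<longlongrightarrow> Q u) (at_right 0)"
    if "has_bornology_ph_derivative \<beta> T Q y" "{u} \<in> \<beta>" for Q
  proof -
    have "((\<lambda>t. ennreal (norm ((T (y + t *\<^sub>R u) - T y) /\<^sub>R t - Q u))) \<longlongrightarrow> ennreal 0) (at_right 0)"
      using that unfolding has_bornology_ph_derivative_def by fastforce
    then have "((\<lambda>t. norm ((T (y + t *\<^sub>R u) - T y) /\<^sub>R t - Q u)) \<longlongrightarrow> 0) (at_right 0)"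
      by (subst (asm) tendsto_ennreal_iff) auto
    then show ?thesis
      using Lim_null tendsto_norm_zero_iff by blast
  qed
  ultimately show "R u = S u"
    using assms(2,3) by (meson tendsto_unique trivial_limit_at_right_real)
qed

lemma bornology_ph_derivative_eq:
  assumes "bornology \<beta>" "has_bornology_ph_derivative \<beta> T R y"
  shows "bornology_ph_derivative \<beta> T y = R"
  unfolding bornology_ph_derivative_def
  using has_bornology_ph_derivative_unique[OF assms(1)] assms(2) by blast

end

theory Submission
  imports Defs
begin

text \<open>Let \<open>R\<close> be the p.h. differential of \<open>T\<close> at \<open>0\<close> and \<open>A \<in> \<beta>Y\<close> with \<open>R ` A \<notin> \<beta>X\<close>. Property
  \<open>(S)\<close> gives points \<open>x n = R (u n)\<close> of the bounded set \<open>R ` A\<close> such that each member of \<open>\<beta>X\<close> comes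
  \<open>\<delta>\<close>-close to only finitely many of them. For a fast decreasing geometric sequence \<open>t n\<close> the balls
  around \<open>T 0 + t n *\<^sub>R x n\<close> of radius \<open>t n * \<delta> / 2\<close> are so well separated that a sum of tents of slopes
  \<open>b n\<close> over them has Lipschitz constant \<open>sup \<bar>b n\<bar>\<close>. At \<open>T 0\<close> it has \<open>\<beta>X\<close>-differential \<open>0\<close> because
  \<open>\<beta>X\<close> misses the balls, whereas along \<open>t n *\<^sub>R u n\<close> its composition with \<open>T\<close> sees the peaks.
  Repeating each coordinate of a bounded sequence for infinitely many \<open>n\<close> embeds the bounded
  sequences isometrically. If \<open>T 0 \<noteq> 0\<close>, the balls are kept away from \<open>0\<close>.\<close>

section \<open>Differentiability as uniform epsilon estimates\<close>

lemma SUP_ennreal_tendsto_0_iff: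
  fixes g :: "'t \<Rightarrow> 'u \<Rightarrow> real"
  assumes "\<And>t u. 0 \<le> g t u"
  shows "((\<lambda>t. SUP u\<in>A. ennreal (g t u)) \<longlongrightarrow> 0) G \<longleftrightarrow>
    (\<forall>\<epsilon>>0. \<forall>\<^sub>F t in G. \<forall>u\<in>A. g t u \<le> \<epsilon>)"
proof
  assume lim: "((\<lambda>t. SUP u\<in>A. ennreal (g t u)) \<longlongrightarrow> 0) G"
  show "\<forall>\<epsilon>>0. \<forall>\<^sub>F t in G. \<forall>u\<in>A. g t u \<le> \<epsilon>"
  proof (intro allI impI)
    fix \<epsilon> :: real assume "\<epsilon> > 0"
    then have "\<forall>\<^sub>F t in G. (SUP u\<in>A. ennreal (g t u)) < ennreal \<epsilon>"
      by (intro order_tendstoD(2)[OF lim]) simp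
    then show "\<forall>\<^sub>F t in G. \<forall>u\<in>A. g t u \<le> \<epsilon>"
    proof eventually_elim
      case (elim t)
      show ?case
      proof
        fix u assume "u \<in> A"
        then have "ennreal (g t u) \<le> ennreal \<epsilon>"
          using elim by (meson SUP_upper le_less_trans less_imp_le)
        then show "g t u \<le> \<epsilon>"
          using \<open>\<epsilon> > 0\<close> by (simp add: ennreal_le_iff)
      qed
    qed
  qed
next
  assume small: "\<forall>\<epsilon>>0. \<forall>\<^sub>F t in G. \<forall>u\<in>A. g t u \<le> \<epsilon>"
  show "((\<lambda>t. SUP u\<in>A. ennreal (g t u)) \<longlongrightarrow> 0) G"
  proof (rule order_tendstoI)
    fix e :: ennreal assume "0 < e"
    \<comment> \<open>A value strictly below \<open>e\<close> is finite. The gap is needed because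
      pointwise bounds control the supremum only up to \<open>\<le> \<epsilon>\<close>.\<close>
    then obtain \<epsilon> where \<epsilon>: "ennreal \<epsilon> < e" "\<epsilon> > 0"
      by (metis dense ennreal_cases ennreal_less_zero_iff infinity_ennreal_def not_less top_greatest)
    with small have "\<forall>\<^sub>F t in G. \<forall>u\<in>A. g t u \<le> \<epsilon>" by blast
    then show "\<forall>\<^sub>F t in G. (SUP u\<in>A. ennreal (g t u)) < e"
    proof eventually_elim
      case (elim t)
      then have "(SUP u\<in>A. ennreal (g t u)) \<le> ennreal \<epsilon>"
        by (intro SUP_least ennreal_leI) auto
      then show ?case using \<epsilon>(1) by simp
    qed
  qed simp
qed

lemma has_bornology_derivative_iff:
  "has_bornology_derivative \<beta> T D y \<longleftrightarrow> bounded_linear D \<and>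
     (\<forall>A\<in>\<beta>. \<forall>\<epsilon>>0. \<forall>\<^sub>F t in at 0. \<forall>u\<in>A. norm ((T (y + t *\<^sub>R u) - T y) /\<^sub>R t - D u) \<le> \<epsilon>)"
  unfolding has_bornology_derivative_def by (subst SUP_ennreal_tendsto_0_iff) simp_all

lemma has_bornology_ph_derivative_iff:
  "has_bornology_ph_derivative \<beta> T R y \<longleftrightarrow> continuous_on UNIV R \<and> positively_homogeneous R \<and>
     (\<forall>A\<in>\<beta>. \<forall>\<epsilon>>0. \<forall>\<^sub>F t in at_right 0. \<forall>u\<in>A.
        norm ((T (y + t *\<^sub>R u) - T y) /\<^sub>R t - R u) \<le> \<epsilon>)"
  unfolding has_bornology_ph_derivative_def by (subst SUP_ennreal_tendsto_0_iff) simp_all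

section \<open>Bornologies, homogeneous maps and sparse sequences\<close>

lemma bornology_singleton: "bornology \<beta> \<Longrightarrow> {u} \<in> \<beta>"
  unfolding bornology_def by (metis UNIV_I UnionE empty_not_insert empty_subsetI insert_subset)

lemma bornology_bounded: "bornology \<beta> \<Longrightarrow> A \<in> \<beta> \<Longrightarrow> bounded A"
  and bornology_nonempty: "bornology \<beta> \<Longrightarrow> A \<in> \<beta> \<Longrightarrow> A \<noteq> {}"
  and bornology_subset: "bornology \<beta> \<Longrightarrow> A \<in> \<beta> \<Longrightarrow> B \<noteq> {} \<Longrightarrow> B \<subseteq> A \<Longrightarrow> B \<in> \<beta>"
  unfolding bornology_def by blast+

text \<open>For \<open>l > 0\<close> this set holds all multiples of points of \<open>A\<close> by
  factors of modulus at most \<open>l\<close>, so sparseness can be applied to all of them at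
  once.\<close>

lemma vector_bornology_scaled_bal:
  fixes \<beta> :: "'a::real_normed_vector set set"
  assumes "vector_bornology \<beta>" "A \<in> \<beta>"
  shows "(\<lambda>a. l *\<^sub>R a) ` bal A \<in> \<beta>"
proof -
  have "(\<lambda>a. 0 + l *\<^sub>R a) ` bal A \<in> \<beta>"
    using assms unfolding vector_bornology_def by blast
  then show ?thesis by simp
qed

lemma positively_homogeneous_bounded_image:
  fixes R :: "'b::real_normed_vector \<Rightarrow> 'a::real_normed_vector"
  assumes cont: "continuous_on UNIV R" and hom: "positively_homogeneous R" and "bounded A"
  shows "bounded (R ` A)"
proof -
  have R0: "R 0 = 0"
    using hom unfolding positively_homogeneous_def by (metis order_refl scale_zero_left)
  have "isCont R 0" using cont continuous_on_eq_continuous_at open_UNIV by blast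
  then obtain d where d: "d > 0" "\<And>x. norm x < d \<Longrightarrow> norm (R x) < 1"
    unfolding continuous_at_eps_delta using R0 by (metis diff_zero dist_norm zero_less_one)
  obtain K where K: "K > 0" "\<And>x. x \<in> A \<Longrightarrow> norm x \<le> K"
    using \<open>bounded A\<close> bounded_pos by blast
  have "norm (R x) \<le> 2 * K / d" if "x \<in> A" for x
  proof -
    define l where "l = d / (2 * K)"
    have l: "l > 0" using d K by (simp add: l_def)
    have "l * norm x \<le> l * K" using K(2)[OF that] l by simp
    also have "\<dots> < d" using d K by (simp add: l_def)
    finally have "norm (R (l *\<^sub>R x)) < 1" using d(2) l by simp
    moreover have "R (l *\<^sub>R x) = l *\<^sub>R R x"
      using hom l unfolding positively_homogeneous_def by simp
    ultimately have "l * norm (R x) < 1" using l by simp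
    then have "norm (R x) < 1 / l" using l by (simp add: field_simps)
    then show ?thesis by (simp add: l_def)
  qed
  then show ?thesis by (auto intro!: boundedI)
qed

text \<open>If some \<open>B \<in> \<beta>\<close> came \<open>\<delta>\<close>-close to infinitely
  many \<open>x n\<close>, nearby points chosen along an enumeration of these indices would form a
  subset of \<open>B\<close>, hence a member of \<open>\<beta>\<close>, against property
  (S).\<close>

lemma property_S_sparse_sequence:
  fixes \<beta> :: "'a::real_normed_vector set set"
  assumes \<beta>: "bornology \<beta>" and S: "property_S \<beta>"
    and A: "A \<noteq> {}" "bounded A" "A \<notin> \<beta>"
  obtains x :: "nat \<Rightarrow> 'a" and \<delta> where "\<delta> > 0" "\<And>n. x n \<in> A" "\<And>n. \<delta> < norm (x n)"
    "\<And>B. B \<in> \<beta> \<Longrightarrow> finite {n. \<exists>y\<in>B. norm (y - x n) \<le> \<delta>}"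
proof -
  obtain x :: "nat \<Rightarrow> 'a" and \<delta> where \<delta>: "\<delta> > 0" and xA: "\<forall>n. x n \<in> A"
    and notin: "\<forall>k :: nat \<Rightarrow> nat. \<forall>y :: nat \<Rightarrow> 'a.
      strict_mono k \<and> (\<forall>i. norm (y i - x (k i)) \<le> \<delta>) \<longrightarrow> range y \<notin> \<beta>"
  proof -
    have "\<exists>x :: nat \<Rightarrow> 'a. \<exists>\<delta>>0. (\<forall>n. x n \<in> A) \<and> (\<forall>k :: nat \<Rightarrow> nat. \<forall>y :: nat \<Rightarrow> 'a.
        strict_mono k \<and> (\<forall>i. norm (y i - x (k i)) \<le> \<delta>) \<longrightarrow> range y \<notin> \<beta>)"
      using S A unfolding property_S_def by simp
    then show ?thesis by (elim exE conjE) (rule that)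
  qed
  have fin: "finite {n. \<exists>y\<in>B. norm (y - x n) \<le> \<delta>}" if "B \<in> \<beta>" for B
  proof (rule ccontr)
    define I where "I = {n. \<exists>y\<in>B. norm (y - x n) \<le> \<delta>}"
    assume "\<not> finite {n. \<exists>y\<in>B. norm (y - x n) \<le> \<delta>}"
    then have inf: "infinite I" by (simp add: I_def)
    then have "\<forall>i. \<exists>y\<in>B. norm (y - x (enumerate I i)) \<le> \<delta>"
      using enumerate_in_set[OF inf] by (auto simp: I_def)
    then obtain y where y: "\<And>i. y i \<in> B" "\<And>i. norm (y i - x (enumerate I i)) \<le> \<delta>"
      by metis
    then have "range y \<notin> \<beta>"
      using notin[rule_format, of "enumerate I" y] strict_mono_enumerate[OF inf] by simp
    moreover have "range y \<in> \<beta>"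
      by (rule bornology_subset[OF \<beta> that]) (simp_all add: y(1) image_subset_iff)
    ultimately show False by blast
  qed
  \<comment> \<open>The singleton of 0 belongs to \<open>\<beta>\<close>, so only finitely many
    terms have norm at most \<open>\<delta>\<close>; shifting by \<open>N\<close> drops
    them.\<close>
  have "finite {n. norm (x n) \<le> \<delta>}"
    using fin[OF bornology_singleton[OF \<beta>, of 0]] by simp
  then obtain N where N: "\<And>n. norm (x n) \<le> \<delta> \<Longrightarrow> n < N"
    using finite_nat_set_iff_bounded by auto
  show thesis
  proof
    show "\<delta> > 0" by fact
    show "x (n + N) \<in> A" for n using xA by simp
    show "\<delta> < norm (x (n + N))" for n using N[of "n + N"] by force
    show "finite {n. \<exists>y\<in>B. norm (y - x (n + N)) \<le> \<delta>}" if "B \<in> \<beta>" for B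
      using finite_vimageI[OF fin[OF that], of "\<lambda>n. n + N"] by (simp add: vimage_def)
  qed
qed

section \<open>Sums of tents over separated balls\<close>

locale separated_balls =
  fixes c :: "nat \<Rightarrow> 'a::metric_space" and \<rho> :: "nat \<Rightarrow> real"
  assumes radius_pos: "0 < \<rho> n"
    and separated: "m \<noteq> n \<Longrightarrow> \<rho> m + \<rho> n \<le> dist (c m) (c n)"
begin

definition ball_index :: "'a \<Rightarrow> nat" where
  "ball_index x = (SOME n. dist x (c n) < \<rho> n)"

definition tent :: "'a \<Rightarrow> real" where
  "tent x = max 0 (\<rho> (ball_index x) - dist x (c (ball_index x)))"

text \<open>Outside all the balls \<^term>\<open>ball_index\<close> is junk, but \<^term>\<open>tent\<close> vanishes there whatever
  its value. As the index does not depend on \<open>b\<close>, the following function is linear in \<open>b\<close>.\<close>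

definition tents :: "(nat \<Rightarrow> real) \<Rightarrow> 'a \<Rightarrow> real" where
  "tents b x = b (ball_index x) * tent x"

lemma ball_index_eq:
  assumes "dist x (c n) < \<rho> n"
  shows "ball_index x = n"
proof (rule ccontr)
  have *: "dist x (c (ball_index x)) < \<rho> (ball_index x)"
    unfolding ball_index_def using assms by (rule someI)
  assume "ball_index x \<noteq> n"
  then show False
    using separated[of "ball_index x" n] assms * dist_triangle2[of "c (ball_index x)" "c n" x]
    by (simp add: dist_commute)
qed

lemma tent_nonneg: "0 \<le> tent x"
  by (simp add: tent_def)

lemma tent_eq_0: "(\<And>n. \<rho> n \<le> dist x (c n)) \<Longrightarrow> tent x = 0"
  by (simp add: tent_def)

lemma tents_eq_0: "(\<And>n. \<rho> n \<le> dist x (c n)) \<Longrightarrow> tents b x = 0"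
  by (simp add: tents_def tent_eq_0)

lemma tents_center: "tents b (c n) = b n * \<rho> n"
  using ball_index_eq[of "c n" n] radius_pos[of n] by (simp add: tents_def tent_def)

text \<open>If both heights are positive, the two radii are absorbed by the distance of the centres.
  The bound on the sum avoids a factor 2 in the Lipschitz constant when slopes have opposite
  signs.\<close>

lemma tent_add_le:
  assumes "ball_index x \<noteq> ball_index y"
  shows "tent x + tent y \<le> dist x y"
proof -
  \<comment> \<open>Even if its own index is junk, \<open>v\<close> lies outside the ball picked for
    \<open>u\<close>, and the height at \<open>u\<close> is at most the distance needed to leave
    that ball.\<close>
  have le: "tent u \<le> dist u v" if "ball_index u \<noteq> ball_index v" for u v
  proof -
    have "\<rho> (ball_index u) \<le> dist v (c (ball_index u))"
      using ball_index_eq[of v "ball_index u"] that by fastforce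
    then show ?thesis
      using dist_triangle[of v "c (ball_index u)" u] by (simp add: tent_def dist_commute)
  qed
  consider "tent x = 0" | "tent y = 0" | "tent x > 0" "tent y > 0"
    using tent_nonneg[of x] tent_nonneg[of y] by linarith
  then show ?thesis
  proof cases
    case 3
    then show ?thesis
      using separated[OF assms] dist_triangle[of "c (ball_index x)" "c (ball_index y)" x]
        dist_triangle[of x "c (ball_index y)" y]
      by (simp add: tent_def dist_commute)
  qed (use le[of x y] le[of y x] assms in \<open>auto simp: dist_commute\<close>)
qed

text \<open>For equal indices the slope factors out of a difference of one 1-Lipschitz tent; for
  different indices \<open>tent_add_le\<close> bounds the sum of the two absolute values.\<close>

lemma tents_lipschitz:
  assumes b: "\<And>n. \<bar>b n\<bar> \<le> B"
  shows "B-lipschitz_on UNIV (tents b)"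
proof (rule lipschitz_onI)
  show "0 \<le> B" using b[of 0] by linarith
  fix x y
  show "dist (tents b x) (tents b y) \<le> B * dist x y"
  proof (cases "ball_index x = ball_index y")
    case True
    have "\<bar>tent x - tent y\<bar> \<le> dist x y"
      using True dist_triangle[of x "c (ball_index x)" y] dist_triangle[of y "c (ball_index x)" x]
      by (auto simp: tent_def dist_commute)
    then have "\<bar>b (ball_index x)\<bar> * \<bar>tent x - tent y\<bar> \<le> B * dist x y"
      using b \<open>0 \<le> B\<close> by (intro mult_mono) auto
    then show ?thesis
      using True by (simp add: tents_def dist_real_def abs_mult right_diff_distrib[symmetric])
  next
    case False
    have "\<bar>tents b z\<bar> \<le> B * tent z" for z
      using b tent_nonneg by (simp add: tents_def abs_mult mult_right_mono)
    then have "\<bar>tents b x - tents b y\<bar> \<le> B * tent x + B * tent y"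
      by (meson abs_triangle_ineq4 add_mono order_trans)
    also have "\<dots> \<le> B * dist x y"
      using tent_add_le[OF False] \<open>0 \<le> B\<close> by (simp add: mult_left_mono flip: distrib_left)
    finally show ?thesis by (simp add: dist_real_def)
  qed
qed

text \<open>The slope is attained between the centre and \<open>y\<close>, since a point on the
  sphere lies in no open ball of the family. The point is assumed because spheres may be empty in a
  metric space.\<close>

lemma abs_le_tents_lipschitz:
  assumes lip: "L-lipschitz_on UNIV (tents b)" and y: "dist y (c n) = \<rho> n"
  shows "\<bar>b n\<bar> \<le> L"
proof -
  have "\<rho> m \<le> dist y (c m)" for m
    using separated[of m n] dist_triangle3[of "c m" "c n" y] y by (cases "m = n") auto
  then have "tents b y = 0" by (rule tents_eq_0)
  then have "\<bar>b n\<bar> * \<rho> n \<le> L * \<rho> n"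
    using lipschitz_onD[OF lip, of "c n" y] radius_pos[of n] y
    by (simp add: tents_center dist_real_def abs_mult dist_commute)
  then show ?thesis using radius_pos[of n] by simp
qed

end

section \<open>Differentials of tent sums and of their compositions\<close>

text \<open>If \<open>p + s *\<^sub>R u\<close> with \<open>u \<in> A\<close> lies in the ball around \<open>p + t n *\<^sub>R x n\<close>, then \<open>(s / t n) *\<^sub>R u\<close> is
  close to \<open>x n\<close>. For all but finitely many \<open>n\<close> this rules out that \<open>s / t n\<close> stays below a given
  bound, so that the height of the tent is small compared with \<open>s\<close>.\<close>

lemma tents_has_bornology_derivative_0:
  fixes \<beta> :: "'a::real_normed_vector set set"
  assumes balls: "separated_balls (\<lambda>n. p + t n *\<^sub>R x n) (\<lambda>n. r * t n)"
    and \<beta>: "vector_bornology \<beta>"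
    and t: "\<And>n. 0 < t n" and r: "0 < r" and far: "\<And>n. r < norm (x n)"
    and sparse: "\<And>B. B \<in> \<beta> \<Longrightarrow> finite {n. \<exists>y\<in>B. norm (y - x n) \<le> r}"
    and b: "\<And>n. \<bar>b n\<bar> \<le> C"
  shows "has_bornology_derivative \<beta>
    (separated_balls.tents (\<lambda>n. p + t n *\<^sub>R x n) (\<lambda>n. r * t n) b) (\<lambda>_. 0) p"
proof -
  interpret separated_balls "\<lambda>n. p + t n *\<^sub>R x n" "\<lambda>n. r * t n" by fact
  have bor: "bornology \<beta>" using \<beta> by (simp add: vector_bornology_def)
  have p0: "tents b p = 0"
  proof (rule tents_eq_0)
    show "r * t n \<le> dist p (p + t n *\<^sub>R x n)" for n
      using far[of n] t[of n] by (simp add: dist_norm)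
  qed
  have "\<forall>\<^sub>F s in at 0. \<forall>u\<in>A. norm ((tents b (p + s *\<^sub>R u) - tents b p) /\<^sub>R s - 0) \<le> \<epsilon>"
    if A: "A \<in> \<beta>" and \<epsilon>: "\<epsilon> > 0" for A \<epsilon>
  proof -
    obtain K where K: "K > 0" "\<And>u. u \<in> A \<Longrightarrow> norm u \<le> K"
      using bornology_bounded[OF bor A] bounded_pos by blast
    have C0: "C \<ge> 0" using b[of 0] by linarith
    \<comment> \<open>With this choice \<open>L < \<bar>s\<bar> / t n\<close> makes
      \<open>\<epsilon> * \<bar>s\<bar>\<close> exceed the bound \<open>C * r * t n\<close> on the
      values in the ball. The summand 1 keeps \<open>L\<close> positive when
      \<open>C = 0\<close>.\<close>
    define L where "L = (C * r + 1) / \<epsilon>"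
    have L: "L > 0" using C0 r \<epsilon> by (simp add: L_def add_nonneg_pos)
    define I where "I = {n. \<exists>y\<in>(\<lambda>a. L *\<^sub>R a) ` bal A. norm (y - x n) \<le> r}"
    have "finite I"
      unfolding I_def by (intro sparse vector_bornology_scaled_bal[OF \<beta> A])
    \<comment> \<open>The finitely many exceptional balls stay away from \<open>p\<close>, so for
      small \<open>s\<close> no \<open>p + s *\<^sub>R u\<close> reaches them.\<close>
    have "\<forall>\<^sub>F s in at 0. \<forall>n\<in>I. \<bar>s\<bar> * K < t n * (norm (x n) - r)"
    proof (intro eventually_ball_finite \<open>finite I\<close> ballI)
      fix n
      have "((\<lambda>s. \<bar>s\<bar> * K) \<longlongrightarrow> \<bar>0\<bar> * K) (at 0)"
        by (intro tendsto_intros)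
      then show "\<forall>\<^sub>F s in at 0. \<bar>s\<bar> * K < t n * (norm (x n) - r)"
        using far[of n] t[of n] by (intro order_tendstoD) auto
    qed
    moreover have "\<forall>\<^sub>F s in at 0. s \<noteq> (0::real)" by (simp add: eventually_at_filter)
    ultimately show ?thesis
    proof eventually_elim
      case (elim s)
      show ?case
      proof
        fix u assume u: "u \<in> A"
        define n where "n = ball_index (p + s *\<^sub>R u)"
        have "\<bar>tents b (p + s *\<^sub>R u)\<bar> \<le> \<epsilon> * \<bar>s\<bar>"
        proof (cases "dist (p + s *\<^sub>R u) (p + t n *\<^sub>R x n) < r * t n")
          case False
          then have "tents b (p + s *\<^sub>R u) = 0" by (simp add: tents_def tent_def n_def)
          then show ?thesis using \<epsilon> by simp
        next
          case True
          then have near: "norm (s *\<^sub>R u - t n *\<^sub>R x n) < r * t n" by (simp add: dist_norm)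
          have "n \<notin> I"
          proof
            assume "n \<in> I"
            with elim have "\<bar>s\<bar> * K < t n * (norm (x n) - r)" by blast
            moreover have "norm (s *\<^sub>R u) \<le> \<bar>s\<bar> * K" using K(2)[OF u] by (simp add: mult_left_mono)
            moreover have "norm (t n *\<^sub>R x n) \<le> norm (s *\<^sub>R u) + norm (s *\<^sub>R u - t n *\<^sub>R x n)"
              by (metis norm_minus_commute norm_triangle_sub)
            ultimately show False using near t[of n] by (simp add: algebra_simps)
          qed
          have "L < \<bar>s\<bar> / t n"
          proof (rule ccontr)
            assume "\<not> L < \<bar>s\<bar> / t n"
            then have "\<bar>s / t n / L\<bar> \<le> 1" using L t[of n] by (simp add: field_simps)
            then have "(s / t n / L) *\<^sub>R u \<in> bal A" using u unfolding bal_def by blast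
            then have "L *\<^sub>R (s / t n / L) *\<^sub>R u \<in> (\<lambda>a. L *\<^sub>R a) ` bal A" by blast
            then have in_bal: "(s / t n) *\<^sub>R u \<in> (\<lambda>a. L *\<^sub>R a) ` bal A" using L by simp
            have "s *\<^sub>R u - t n *\<^sub>R x n = t n *\<^sub>R ((s / t n) *\<^sub>R u - x n)"
              using t[of n] by (simp add: scaleR_diff_right)
            then have "t n * norm ((s / t n) *\<^sub>R u - x n) < r * t n"
              using near t[of n] by simp
            then have "norm ((s / t n) *\<^sub>R u - x n) \<le> r" using t[of n] by (simp add: mult.commute)
            with in_bal \<open>n \<notin> I\<close> show False by (auto simp: I_def)
          qed
          then have "(C * r + 1) * t n \<le> \<epsilon> * \<bar>s\<bar>"
            using \<epsilon> t[of n] by (simp add: L_def field_simps)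
          moreover have "\<bar>tents b (p + s *\<^sub>R u)\<bar> \<le> C * (r * t n)"
            unfolding tents_def abs_mult using b r t[of n] C0
            by (intro mult_mono) (auto simp: tent_def simp flip: n_def)
          ultimately show ?thesis using t[of n] by (simp add: algebra_simps)
        qed
        then show "norm ((tents b (p + s *\<^sub>R u) - tents b p) /\<^sub>R s - 0) \<le> \<epsilon>"
          using p0 elim by (simp add: field_simps abs_mult)
      qed
    qed
  qed
  then show ?thesis by (simp add: has_bornology_derivative_iff)
qed

text \<open>Serves the case \<open>T 0 \<noteq> 0\<close>, where the tents accumulate at
  \<open>T 0\<close> but the differential is required at 0.\<close>

lemma has_bornology_derivative_0_if_vanishes_near_0:
  fixes f :: "'a::real_normed_vector \<Rightarrow> 'b::real_normed_vector"
  assumes \<beta>: "bornology \<beta>" and d: "d > 0" and f: "\<And>x. norm x < d \<Longrightarrow> f x = 0"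
  shows "has_bornology_derivative \<beta> f (\<lambda>_. 0) 0"
proof -
  have "\<forall>\<^sub>F s in at 0. \<forall>u\<in>A. norm ((f (0 + s *\<^sub>R u) - f 0) /\<^sub>R s - 0) \<le> \<epsilon>"
    if A: "A \<in> \<beta>" and \<epsilon>: "\<epsilon> > 0" for A \<epsilon>
  proof -
    obtain K where K: "K > 0" "\<And>u. u \<in> A \<Longrightarrow> norm u \<le> K"
      using bornology_bounded[OF \<beta> A] bounded_pos by blast
    have "((\<lambda>s. \<bar>s\<bar> * K) \<longlongrightarrow> \<bar>0\<bar> * K) (at 0)"
      by (intro tendsto_intros)
    then have "\<forall>\<^sub>F s in at 0. \<bar>s\<bar> * K < d" using d by (intro order_tendstoD) auto
    then show ?thesis
    proof eventually_elim
      case (elim s)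
      have "f (s *\<^sub>R u) = 0" if "u \<in> A" for u
      proof (rule f)
        have "norm (s *\<^sub>R u) \<le> \<bar>s\<bar> * K" using K(2)[OF that] by (simp add: mult_left_mono)
        then show "norm (s *\<^sub>R u) < d" using elim by linarith
      qed
      moreover have "f 0 = 0" using f d by simp
      ultimately show ?case using \<epsilon> by simp
    qed
  qed
  then show ?thesis by (simp add: has_bornology_derivative_iff)
qed

text \<open>Evaluating at a single direction \<open>u\<close>, the derivative of the composition can only be the
  derivative of \<open>f\<close> in the direction \<open>R u\<close>.\<close>

lemma bornology_derivative_comp_eq_0:
  fixes T :: "'b::real_normed_vector \<Rightarrow> 'a::real_normed_vector" and f :: "'a \<Rightarrow> real"
  assumes \<beta>X: "bornology \<beta>X" and \<beta>Y: "bornology \<beta>Y"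
    and T: "has_bornology_ph_derivative \<beta>Y T R y"
    and lip: "C-lipschitz_on UNIV f"
    and f: "has_bornology_derivative \<beta>X f (\<lambda>_. 0) (T y)"
    and D: "has_bornology_derivative \<beta>Y (f \<circ> T) D y"
  shows "D u = 0"
proof -
  have C: "C \<ge> 0" using lip by (rule lipschitz_on_nonneg)
  have "\<bar>D u\<bar> \<le> \<epsilon>" if "\<epsilon> > 0" for \<epsilon>
  proof -
    \<comment> \<open>Three errors add up to \<open>\<epsilon>\<close>: \<open>C * e\<close> for
      replacing \<open>T (y + t *\<^sub>R u)\<close> by \<open>T y + t *\<^sub>R R u\<close>, and
      \<open>e\<close> for each of the two differentials.\<close>
    define e where "e = \<epsilon> / (2 + C)"
    have e: "e > 0" using that C by (simp add: e_def)
    have le: "at_right 0 \<le> (at 0 :: real filter)" by (simp add: at_le)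
    have "\<forall>\<^sub>F t in at 0. norm ((f (T y + t *\<^sub>R R u) - f (T y)) /\<^sub>R t - 0) \<le> e"
      using f e bornology_singleton[OF \<beta>X, of "R u"]
      unfolding has_bornology_derivative_iff by fastforce
    then have "\<forall>\<^sub>F t in at_right 0. norm ((f (T y + t *\<^sub>R R u) - f (T y)) /\<^sub>R t - 0) \<le> e"
      by (rule filter_leD[OF le])
    moreover have "\<forall>\<^sub>F t in at 0. norm (((f \<circ> T) (y + t *\<^sub>R u) - (f \<circ> T) y) /\<^sub>R t - D u) \<le> e"
      using D e bornology_singleton[OF \<beta>Y, of u]
      unfolding has_bornology_derivative_iff by fastforce
    then have "\<forall>\<^sub>F t in at_right 0. norm (((f \<circ> T) (y + t *\<^sub>R u) - (f \<circ> T) y) /\<^sub>R t - D u) \<le> e"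
      by (rule filter_leD[OF le])
    moreover have "\<forall>\<^sub>F t in at_right 0. norm ((T (y + t *\<^sub>R u) - T y) /\<^sub>R t - R u) \<le> e"
      using T e bornology_singleton[OF \<beta>Y, of u]
      unfolding has_bornology_ph_derivative_iff by fastforce
    moreover have "\<forall>\<^sub>F t in at_right 0. t > (0::real)" by (simp add: eventually_at_right_less)
    ultimately have "\<forall>\<^sub>F t in at_right (0::real). \<bar>D u\<bar> \<le> \<epsilon>"
    proof eventually_elim
      case (elim t)
      have "T (y + t *\<^sub>R u) - (T y + t *\<^sub>R R u) = t *\<^sub>R ((T (y + t *\<^sub>R u) - T y) /\<^sub>R t - R u)"
        using elim(4) by (simp add: scaleR_diff_right)
      then have "dist (T (y + t *\<^sub>R u)) (T y + t *\<^sub>R R u)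
          = t * norm ((T (y + t *\<^sub>R u) - T y) /\<^sub>R t - R u)"
        using elim(4) by (simp add: dist_norm)
      also have "\<dots> \<le> t * e" using elim(3,4) by simp
      finally have "dist (T (y + t *\<^sub>R u)) (T y + t *\<^sub>R R u) \<le> t * e" .
      then have "\<bar>f (T (y + t *\<^sub>R u)) - f (T y + t *\<^sub>R R u)\<bar> \<le> C * (t * e)"
        using lipschitz_onD[OF lip, of "T (y + t *\<^sub>R u)" "T y + t *\<^sub>R R u"] C
        by (simp add: dist_real_def) (meson mult_left_mono order_trans)
      then have 1: "\<bar>(f (T (y + t *\<^sub>R u)) - f (T y + t *\<^sub>R R u)) / t\<bar> \<le> C * e"
        using elim(4) by (simp add: field_simps)
      have "D u = (f (T (y + t *\<^sub>R u)) - f (T y + t *\<^sub>R R u)) / t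
          + (f (T y + t *\<^sub>R R u) - f (T y)) / t - ((f (T (y + t *\<^sub>R u)) - f (T y)) / t - D u)"
        by (simp add: diff_divide_distrib)
      then have "\<bar>D u\<bar> \<le> C * e + e + e"
        using 1 elim(1,2) by (simp add: divide_inverse_commute)
      also have "\<dots> = (2 + C) * e" by (simp add: algebra_simps)
      also have "\<dots> = \<epsilon>" using C by (simp add: e_def)
      finally show ?case .
    qed
    then show ?thesis by simp
  qed
  then show ?thesis by (metis abs_le_zero_iff field_le_epsilon add_0)
qed

text \<open>The ratio is such that, for \<open>m < n\<close>, ball \<open>n\<close> lies within
  \<open>r * t m\<close> of \<open>p\<close> (writing \<open>t m\<close> for the scale), whereas
  ball \<open>m\<close> stays outside that radius because its centre is at least
  \<open>2 * r * t m\<close> away.\<close>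

lemma separated_balls_geometric:
  fixes p :: "'a::real_normed_vector"
  assumes r: "0 < r" and far: "\<And>n. 2 * r \<le> norm (x n)" and M: "\<And>n. norm (x n) \<le> M"
    and \<tau>: "0 < \<tau>"
  shows "separated_balls (\<lambda>n. p + (\<tau> * (r / (M + r)) ^ n) *\<^sub>R x n) (\<lambda>n. r * (\<tau> * (r / (M + r)) ^ n))"
proof
  define q where "q = r / (M + r)"
  define t where "t = (\<lambda>n. \<tau> * q ^ n)"
  have M0: "M > 0" using M[of 0] far[of 0] r by linarith
  have q: "0 < q" "q \<le> 1" using r M0 by (auto simp: q_def field_simps)
  have t: "t n > 0" for n using \<tau> q by (simp add: t_def)
  have sep: "r * t m + r * t n \<le> dist (p + t m *\<^sub>R x m) (p + t n *\<^sub>R x n)" if "m < n" for m n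
  proof -
    have "q ^ n \<le> q ^ Suc m" using q that by (intro power_decreasing) auto
    then have "t n \<le> t m * q" using \<tau> by (simp add: t_def mult_left_mono mult.assoc mult.commute)
    then have "t n * (M + r) \<le> t m * r" using r M0 by (simp add: q_def field_simps)
    moreover have "t m * (2 * r) \<le> norm (t m *\<^sub>R x m)" "norm (t n *\<^sub>R x n) \<le> t n * M"
      using far M t[of m] t[of n] by (simp_all add: mult_left_mono)
    moreover have "norm (t m *\<^sub>R x m) - norm (t n *\<^sub>R x n)
        \<le> dist (p + t m *\<^sub>R x m) (p + t n *\<^sub>R x n)"
      using norm_triangle_ineq2[of "t m *\<^sub>R x m" "t n *\<^sub>R x n"] by (simp add: dist_norm)
    ultimately show ?thesis by (simp add: algebra_simps)
  qed
  show "0 < r * (\<tau> * (r / (M + r)) ^ n)" for n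
    using r t[of n] by (simp add: t_def q_def)
  show "r * (\<tau> * (r / (M + r)) ^ m) + r * (\<tau> * (r / (M + r)) ^ n)
      \<le> dist (p + (\<tau> * (r / (M + r)) ^ m) *\<^sub>R x m) (p + (\<tau> * (r / (M + r)) ^ n) *\<^sub>R x n)"
    if "m \<noteq> n" for m n
    using sep[of m n] sep[of n m] that unfolding t_def q_def
    by (metis add.commute dist_commute linorder_neqE_nat)
qed

text \<open>At \<open>t n *\<^sub>R u n\<close> the difference quotient of the composition is close to \<open>b n * r\<close>, but its
  derivative would have to vanish.\<close>

lemma tents_comp_not_bornology_differentiable:
  fixes T :: "'b::real_normed_vector \<Rightarrow> 'a::real_normed_vector"
  assumes balls: "separated_balls (\<lambda>n. T y + t n *\<^sub>R R (u n)) (\<lambda>n. r * t n)"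
    and \<beta>X: "bornology \<beta>X" and \<beta>Y: "bornology \<beta>Y"
    and T: "has_bornology_ph_derivative \<beta>Y T R y"
    and f: "f = separated_balls.tents (\<lambda>n. T y + t n *\<^sub>R R (u n)) (\<lambda>n. r * t n) b"
    and lip: "C-lipschitz_on UNIV f"
    and deriv: "has_bornology_derivative \<beta>X f (\<lambda>_. 0) (T y)"
    and A: "A \<in> \<beta>Y" "\<And>n. u n \<in> A"
    and t: "\<And>n. 0 < t n" "t \<longlonglongrightarrow> 0" and r: "0 < r" and far: "\<And>n. r \<le> norm (R (u n))"
    and b: "b0 \<noteq> 0" "\<exists>\<^sub>F n in sequentially. b n = b0"
  shows "\<not> bornology_differentiable \<beta>Y (f \<circ> T) y"
proof
  interpret separated_balls "\<lambda>n. T y + t n *\<^sub>R R (u n)" "\<lambda>n. r * t n" by fact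
  assume "bornology_differentiable \<beta>Y (f \<circ> T) y"
  then obtain D where D: "has_bornology_derivative \<beta>Y (f \<circ> T) D y"
    unfolding bornology_differentiable_def by blast
  have D0: "D v = 0" for v
    using bornology_derivative_comp_eq_0[OF \<beta>X \<beta>Y T lip deriv D] .
  have C: "C \<ge> 0" using lip by (rule lipschitz_on_nonneg)
  \<comment> \<open>The peak \<open>b0 * r * t n\<close> would have modulus at most
    \<open>(C + 1) * e * t n\<close>, whereas
    \<open>\<bar>b0\<bar> * r = (2 + C) * e\<close>.\<close>
  define e where "e = \<bar>b0\<bar> * r / (2 + C)"
  have e: "e > 0" using b r C by (simp add: e_def)
  have "f (T y) = 0" unfolding f
  proof (rule tents_eq_0)
    show "r * t n \<le> dist (T y) (T y + t n *\<^sub>R R (u n))" for n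
      using far[of n] t(1)[of n] by (simp add: dist_norm)
  qed
  have lim: "filterlim t (at_right 0) sequentially"
    unfolding filterlim_at using t by (auto simp: less_imp_neq[symmetric])
  have "at_right 0 \<le> (at 0 :: real filter)" by (simp add: at_le)
  then have lim0: "filterlim t (at 0) sequentially"
    using lim filterlim_mono by blast
  have "\<forall>\<^sub>F s in at 0. \<forall>v\<in>A. norm (((f \<circ> T) (y + s *\<^sub>R v) - (f \<circ> T) y) /\<^sub>R s - D v) \<le> e"
    using D e A(1) unfolding has_bornology_derivative_iff by blast
  then have ev1: "\<forall>\<^sub>F n in sequentially.
      \<forall>v\<in>A. norm (((f \<circ> T) (y + t n *\<^sub>R v) - (f \<circ> T) y) /\<^sub>R t n - D v) \<le> e"
    using lim0 by (rule eventually_compose_filterlim)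
  have "\<forall>\<^sub>F s in at_right 0. \<forall>v\<in>A. norm ((T (y + s *\<^sub>R v) - T y) /\<^sub>R s - R v) \<le> e"
    using T e A(1) unfolding has_bornology_ph_derivative_iff by blast
  then have ev2: "\<forall>\<^sub>F n in sequentially.
      \<forall>v\<in>A. norm ((T (y + t n *\<^sub>R v) - T y) /\<^sub>R t n - R v) \<le> e"
    using lim by (rule eventually_compose_filterlim)
  \<comment> \<open>The first condition holds for infinitely many \<open>n\<close>, the two
    estimates for almost all.\<close>
  obtain n where n: "b n = b0"
      "\<bar>(f (T (y + t n *\<^sub>R u n)) - f (T y)) / t n\<bar> \<le> e"
      "norm ((T (y + t n *\<^sub>R u n) - T y) /\<^sub>R t n - R (u n)) \<le> e"
    using frequently_ex[OF frequently_eventually_conj[OF b(2) eventually_conj[OF ev1 ev2]]]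
    A(2) D0 by (auto simp: divide_inverse_commute)
  have "T (y + t n *\<^sub>R u n) - (T y + t n *\<^sub>R R (u n))
      = t n *\<^sub>R ((T (y + t n *\<^sub>R u n) - T y) /\<^sub>R t n - R (u n))"
    using t(1)[of n] by (simp add: scaleR_diff_right)
  then have "dist (T (y + t n *\<^sub>R u n)) (T y + t n *\<^sub>R R (u n))
      = t n * norm ((T (y + t n *\<^sub>R u n) - T y) /\<^sub>R t n - R (u n))"
    using t(1)[of n] by (simp add: dist_norm)
  also have "\<dots> \<le> t n * e" using n(3) t(1)[of n] by simp
  finally have "dist (T (y + t n *\<^sub>R u n)) (T y + t n *\<^sub>R R (u n)) \<le> t n * e" .
  then have "\<bar>f (T (y + t n *\<^sub>R u n)) - f (T y + t n *\<^sub>R R (u n))\<bar> \<le> C * (t n * e)"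
    using lipschitz_onD[OF lip, of "T (y + t n *\<^sub>R u n)" "T y + t n *\<^sub>R R (u n)"] C
    by (simp add: dist_real_def) (meson mult_left_mono order_trans)
  moreover have "\<bar>f (T (y + t n *\<^sub>R u n))\<bar> \<le> e * t n"
    using n(2) t(1)[of n] \<open>f (T y) = 0\<close> by (simp add: field_simps)
  moreover have "f (T y + t n *\<^sub>R R (u n)) = b0 * (r * t n)"
    using n(1) by (simp add: f tents_center)
  ultimately have "\<bar>b0 * (r * t n)\<bar> \<le> C * (t n * e) + e * t n" by linarith
  moreover have "\<bar>b0 * (r * t n)\<bar> = (2 + C) * e * t n"
    using r t(1)[of n] C by (simp add: e_def abs_mult)
  ultimately show False using e t(1)[of n] by (simp add: algebra_simps)
qed

section \<open>The isometric embedding of the bounded sequences\<close>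

theorem corollary6p9:
  fixes \<beta>X :: "'x::banach set set" and \<beta>Y :: "'y::banach set set" and T :: "'y \<Rightarrow> 'x"
    and F :: "'x lip0 set"
  assumes "vector_bornology \<beta>X" and "vector_bornology \<beta>Y"
    and "property_S \<beta>X"
    and "bornology_ph_differentiable \<beta>Y T 0"
    and "\<not> bornology_operator \<beta>Y \<beta>X (bornology_ph_derivative \<beta>Y T 0)"
  defines "F \<equiv> {f. has_bornology_derivative \<beta>X (lip0_apply f) (\<lambda>_. 0) 0 \<and>
                   \<not> bornology_differentiable \<beta>Y (lip0_apply f \<circ> T) 0}"
  shows "\<exists>V. subspace V \<and> V \<subseteq> F \<union> {0} \<and>
           (\<exists>\<phi> :: (nat \<Rightarrow>\<^sub>C real) \<Rightarrow> 'x lip0. linear \<phi> \<and> (\<forall>a. norm (\<phi> a) = norm a) \<and> range \<phi> = V)"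
proof -
  have \<beta>X: "bornology \<beta>X" and \<beta>Y: "bornology \<beta>Y"
    using assms(1,2) by (simp_all add: vector_bornology_def)
  obtain R where R: "has_bornology_ph_derivative \<beta>Y T R 0"
    using assms(4) unfolding bornology_ph_differentiable_def by blast
  then have "\<not> bornology_operator \<beta>Y \<beta>X R"
    using assms(5) bornology_ph_derivative_eq[OF \<beta>Y] by metis
  then obtain A where A: "A \<in> \<beta>Y" "R ` A \<notin> \<beta>X"
    unfolding bornology_operator_def by blast
  have bdd: "bounded (R ` A)"
    using R bornology_bounded[OF \<beta>Y A(1)]
    by (intro positively_homogeneous_bounded_image) (auto simp: has_bornology_ph_derivative_def)
  have nonempty: "R ` A \<noteq> {}" using bornology_nonempty[OF \<beta>Y A(1)] by simp
  obtain x :: "nat \<Rightarrow> 'x" and \<delta> where \<delta>: "\<delta> > 0" and xA: "\<And>n. x n \<in> R ` A" and far: "\<And>n. \<delta> < norm (x n)"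
    and sparse: "\<And>B. B \<in> \<beta>X \<Longrightarrow> finite {n. \<exists>y\<in>B. norm (y - x n) \<le> \<delta>}"
    by (rule property_S_sparse_sequence[OF \<beta>X assms(3) nonempty bdd A(2)]) (rule that)
  have "\<forall>n. \<exists>v\<in>A. x n = R v" using xA by blast
  then obtain u where u: "\<And>n. u n \<in> A" "\<And>n. x n = R (u n)" by metis
  obtain M where M: "\<And>n. norm (x n) \<le> M" using bdd xA by (meson bounded_iff)
  \<comment> \<open>Halving \<open>\<delta>\<close> gives \<open>2 * r \<le> norm (x n)\<close>, as
    the geometric separation requires, and preserves sparseness.\<close>
  define r where "r = \<delta> / 2"
  have r: "r > 0" using \<delta> by (simp add: r_def)
  have M0: "M > 0" using M[of 0] far[of 0] \<delta> by linarith
  \<comment> \<open>All balls will lie within \<open>d\<close> of \<open>T 0\<close>, so for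
    \<open>T 0 \<noteq> 0\<close> they miss the open ball of radius \<open>d\<close> around 0. For
    \<open>T 0 = 0\<close> the value 1 is arbitrary.\<close>
  define d where "d = (if T 0 = 0 then 1 else norm (T 0) / 2)"
  have d: "d > 0" by (simp add: d_def)
  define \<tau> where "\<tau> = d / (M + r)"
  have \<tau>: "\<tau> > 0" using d M0 r by (simp add: \<tau>_def)
  define q where "q = r / (M + r)"
  have q: "0 < q" "q < 1" using M0 r by (simp_all add: q_def)
  define t where "t = (\<lambda>n. \<tau> * q ^ n)"
  have t: "t n > 0" for n using \<tau> q by (simp add: t_def)
  have "(\<lambda>n. \<tau> * q ^ n) \<longlonglongrightarrow> \<tau> * 0"
    using q by (intro tendsto_intros) auto
  then have t_lim: "t \<longlonglongrightarrow> 0" by (simp add: t_def)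
  have t_le: "t n * (M + r) \<le> d" for n
  proof -
    have "t n \<le> \<tau>" using q \<tau> by (simp add: t_def mult_left_le power_le_one)
    then have "t n * (M + r) \<le> \<tau> * (M + r)" using M0 r by (intro mult_right_mono) auto
    then show ?thesis using M0 r by (simp add: \<tau>_def)
  qed
  have far_r: "r < norm (x n)" "2 * r \<le> norm (x n)" for n
    using far[of n] \<delta> by (auto simp: r_def)
  have balls: "separated_balls (\<lambda>n. T 0 + t n *\<^sub>R x n) (\<lambda>n. r * t n)"
    unfolding t_def q_def using separated_balls_geometric[OF r far_r(2) M \<tau>] .
  interpret separated_balls "\<lambda>n. T 0 + t n *\<^sub>R x n" "\<lambda>n. r * t n" by (rule balls)
  \<comment> \<open>The case \<open>z = 0\<close> puts the tent sums into the space of functions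
    vanishing at 0; the other case gives differential 0 there when
    \<open>T 0 \<noteq> 0\<close>.\<close>
  have near0: "tents b z = 0" if z: "z = 0 \<or> (T 0 \<noteq> 0 \<and> norm z < d)" for b z
  proof (rule tents_eq_0)
    fix n
    show "r * t n \<le> dist z (T 0 + t n *\<^sub>R x n)"
    proof (cases "T 0 = 0")
      case True
      then show ?thesis using z far_r(1)[of n] t[of n] by (simp add: dist_norm)
    next
      case False
      have "norm (t n *\<^sub>R x n) \<le> t n * M" using M t[of n] by simp
      moreover have "norm z \<le> d" using z d by auto
      moreover have "norm (T 0) = 2 * d" using False by (simp add: d_def)
      moreover have "norm (T 0) \<le> dist z (T 0 + t n *\<^sub>R x n) + norm z + norm (t n *\<^sub>R x n)"
        using norm_triangle_ineq4[of z "t n *\<^sub>R x n"]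
          norm_triangle_sub[of "T 0" "z - t n *\<^sub>R x n"]
        by (simp add: dist_norm norm_minus_commute algebra_simps)
      ultimately show ?thesis using t_le[of n] by (simp add: algebra_simps)
    qed
  qed
  text \<open>Every coordinate of \<open>a\<close> is used for infinitely many tents.\<close>
  define b :: "(nat \<Rightarrow>\<^sub>C real) \<Rightarrow> nat \<Rightarrow> real"
    where "b a n = apply_bcontfun a (fst (prod_decode n))" for a n
  have b_le: "\<bar>b a n\<bar> \<le> norm a" for a n
    using norm_bounded[of a "fst (prod_decode n)"] by (simp add: b_def)
  have lip: "(norm a)-lipschitz_on UNIV (tents (b a))" for a
    using b_le by (rule tents_lipschitz)
  \<comment> \<open>On the discrete space of naturals every function is continuous, so
    \<open>nat \<Rightarrow>\<^sub>C real\<close> consists of all bounded sequences with the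
    supremum norm.\<close>
  define \<phi> :: "(nat \<Rightarrow>\<^sub>C real) \<Rightarrow> 'x lip0" where "\<phi> a = Abs_lip0 (tents (b a))" for a
  have \<phi>: "lip0_apply (\<phi> a) = tents (b a)" for a
    unfolding \<phi>_def using lip near0 by (intro Abs_lip0_inverse) (auto simp: is_lip0_def)
  have "linear \<phi>"
    by (rule linearI; rule lip0_eqI)
      (simp_all add: \<phi> plus_lip0.rep_eq scaleR_lip0.rep_eq tents_def b_def algebra_simps)
  have norm_\<phi>: "norm (\<phi> a) = norm a" for a
  proof (rule antisym)
    show "norm (\<phi> a) \<le> norm a"
      unfolding norm_lip0.rep_eq \<phi> using lip by (rule Lip_le)
    show "norm a \<le> norm (\<phi> a)"
    proof (rule norm_bound)
      fix j
      \<comment> \<open>Any index encoding coordinate \<open>j\<close> would do. The point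
        \<open>z\<close> is reached from the centre by going one radius in the direction
        \<open>x n\<close>, which is nonzero.\<close>
      define n where "n = prod_encode (j, 0)"
      define z where "z = T 0 + t n *\<^sub>R x n + (r * t n / norm (x n)) *\<^sub>R x n"
      have "dist z (T 0 + t n *\<^sub>R x n) = r * t n"
        using far_r(1)[of n] r t[of n] by (cases "x n = 0") (simp_all add: z_def dist_norm)
      then have "\<bar>b a n\<bar> \<le> norm (\<phi> a)"
        using abs_le_tents_lipschitz[OF lipschitz_on_Lip[OF lip]]
        by (simp add: norm_lip0.rep_eq \<phi>)
      then show "norm (apply_bcontfun a j) \<le> norm (\<phi> a)" by (simp add: b_def n_def)
    qed
  qed
  have "\<phi> a \<in> F" if "a \<noteq> 0" for a
  proof -
    obtain j where j: "apply_bcontfun a j \<noteq> 0"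
      using \<open>a \<noteq> 0\<close> by (metis bcontfun_eqI zero_bcontfun.rep_eq)
    have sparse_r: "finite {n. \<exists>y\<in>B. norm (y - x n) \<le> r}" if "B \<in> \<beta>X" for B
    proof (rule finite_subset[OF _ sparse[OF that]])
      have "r \<le> \<delta>" using \<delta> by (simp add: r_def)
      then show "{n. \<exists>y\<in>B. norm (y - x n) \<le> r} \<subseteq> {n. \<exists>y\<in>B. norm (y - x n) \<le> \<delta>}"
        by (blast intro: order_trans)
    qed
    have deriv: "has_bornology_derivative \<beta>X (tents (b a)) (\<lambda>_. 0) (T 0)"
      by (rule tents_has_bornology_derivative_0[OF balls assms(1) t r far_r(1) sparse_r b_le])
    \<comment> \<open>Membership in \<open>F\<close> concerns the differential at 0, while the
      composition argument uses the one at \<open>T 0\<close>.\<close>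
    have "has_bornology_derivative \<beta>X (tents (b a)) (\<lambda>_. 0) 0"
    proof (cases "T 0 = 0")
      case False
      then show ?thesis
        using near0 d by (intro has_bornology_derivative_0_if_vanishes_near_0[OF \<beta>X]) auto
    qed (use deriv in simp)
    moreover have "\<not> bornology_differentiable \<beta>Y (tents (b a) \<circ> T) 0"
    proof (rule tents_comp_not_bornology_differentiable[where R = R and u = u and b = "b a"])
      show "\<exists>\<^sub>F n in sequentially. b a n = apply_bcontfun a j"
        unfolding frequently_sequentially
      proof
        fix N
        have "N \<le> prod_encode (j, N)" by (rule le_prod_encode_2)
        moreover have "b a (prod_encode (j, N)) = apply_bcontfun a j" by (simp add: b_def)
        ultimately show "\<exists>n\<ge>N. b a n = apply_bcontfun a j" by blast
      qed
      show "separated_balls (\<lambda>n. T 0 + t n *\<^sub>R R (u n)) (\<lambda>n. r * t n)"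
        using balls by (simp add: u(2))
      show "tents (b a)
          = separated_balls.tents (\<lambda>n. T 0 + t n *\<^sub>R R (u n)) (\<lambda>n. r * t n) (b a)"
        by (simp add: u(2))
      show "r \<le> norm (R (u n))" for n
        using far_r(1)[of n] by (simp add: u(2))
    qed (fact \<beta>X \<beta>Y R lip deriv A(1) u(1) t t_lim r j)+
    ultimately show ?thesis by (simp add: F_def \<phi>)
  qed
  moreover have "\<phi> 0 = 0" using \<open>linear \<phi>\<close> by (rule linear_0)
  ultimately have "range \<phi> \<subseteq> F \<union> {0}" by force
  moreover have "subspace (range \<phi>)"
    using \<open>linear \<phi>\<close> subspace_UNIV by (rule linear_subspace_image)
  ultimately show ?thesis using \<open>linear \<phi>\<close> norm_\<phi> by blast
qed

end
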